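(* Let $A,C,Q\in\mathbb{R}^{n\times n}$, $B,N\in\mathbb{R}^{n\times m}$, $R\in\mathbb{R}^{m\times m}$, with $Q$ symmetric positive-semidefinite and $R$ symmetric positive-definite, let $0\neq\lambda\in\mathbb{R}^n$ and $\Sigma=\{x\in\mathbb{R}^n:\lambda^\top x=0\}$. Suppose that the hybrid control system $$\begin{cases}\dot x=Ax+Bu, & x\notin\Sigma,\\ x^+=Cx, & x\in\Sigma,\end{cases}$$ (i.e. with affine term $b=0$) has weakly actuated resets. Then for any $x\in\Sigma\setminus(\Sigma^A\cup\Sigma_1)$, a unique solution exists to the co-state jump conditions $$p^-=C^\top p^++\varepsilon\lambda,\qquad H(Cx,p^+)=H(x,p^-),$$ that is, for each given post-reset co-state $p^+\in\mathbb{R}^n$ there is exactly one multiplier $\varepsilon\in\mathbb{R}$ (and hence exactly one $p^-$) satisfying them.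
   Context: The Hamiltonian is $H(x,p)=\frac12x^\top\tilde Qx+p^\top\tilde Ax-\frac12p^\top\tilde Rp$ with $\tilde Q=Q-NR^{-1}N^\top$, $\tilde A=A-BR^{-1}N^\top$, $\tilde R=BR^{-1}B^\top$. The system has weakly actuated resets if all control vector fields (here the columns of $B$) are tangent to $\Sigma$ at every point of $\Sigma$. The first-beating set is $\Sigma_1=\{x\in\mathbb{R}^n:\lambda^\top x=0=\lambda^\top Cx\}$, and the invariant guard is $\Sigma^A=\{x\in\Sigma:\lambda^\top Ax=0\}=\ker\lambda^\top\cap\ker\lambda^\top A$. Here $x=x^-$ denotes the pre-reset state and $p^+$ the post-reset co-state. *)

theory Defs
  imports "HOL-Analysis.Analysis"
begin

definition psd_matrix :: "real^'n^'n \<Rightarrow> bool" where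
  "psd_matrix Q \<longleftrightarrow> transpose Q = Q \<and> (\<forall>v. v \<bullet> (Q *v v) \<ge> 0)"

definition pd_matrix :: "real^'n^'n \<Rightarrow> bool" where
  "pd_matrix R \<longleftrightarrow> transpose R = R \<and> (\<forall>v. v \<noteq> 0 \<longrightarrow> v \<bullet> (R *v v) > 0)"

(* Velocities at x of C^1 curves that stay in S. For an embedded submanifold S
   this is the usual tangent space T_x S. *)
definition tangent_vectors :: "'a::real_normed_vector set \<Rightarrow> 'a \<Rightarrow> 'a set" where
  "tangent_vectors S x =
    {v. \<exists>\<gamma> e. e > 0 \<and> \<gamma> C1_differentiable_on {-e<..<e} \<and> \<gamma> ` {-e<..<e} \<subseteq> S \<and>
        \<gamma> 0 = x \<and> (\<gamma> has_vector_derivative v) (at (0::real))}"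

(* x' = drift x + (sum over i of u_i * control_field i x) off the guard;
   x^+ = reset x on the guard. *)
record ('n, 'm) hybrid_control_system =
  drift :: "real^'n \<Rightarrow> real^'n"
  control_field :: "'m \<Rightarrow> real^'n \<Rightarrow> real^'n"
  guard :: "(real^'n) set"
  reset :: "real^'n \<Rightarrow> real^'n"

definition weakly_actuated_resets :: "('n::finite, 'm) hybrid_control_system \<Rightarrow> bool" where
  "weakly_actuated_resets H \<longleftrightarrow>
    (\<forall>i. \<forall>x\<in>guard H. control_field H i x \<in> tangent_vectors (guard H) x)"

definition guard_hyperplane :: "real^'n \<Rightarrow> (real^'n) set" where
  "guard_hyperplane l = {x. l \<bullet> x = 0}"

definition linear_hybrid_system ::
  "real^'n^'n \<Rightarrow> real^'m^'n \<Rightarrow> real^'n^'n \<Rightarrow> real^'n \<Rightarrow> ('n, 'm) hybrid_control_system" where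
  "linear_hybrid_system A B C l =
    \<lparr>drift = (\<lambda>x. A *v x), control_field = (\<lambda>i x. column i B),
     guard = guard_hyperplane l, reset = (\<lambda>x. C *v x)\<rparr>"

lemma linear_hybrid_system_dynamics:
  fixes A C :: "real^'n^'n" and B :: "real^'m^'n" and l :: "real^'n"
  defines "S \<equiv> linear_hybrid_system A B C l"
  shows "drift S x + (\<Sum>i\<in>UNIV. (u $ i) *\<^sub>R control_field S i x) = A *v x + B *v u"
  by (simp add: S_def linear_hybrid_system_def matrix_mult_sum scalar_mult_eq_scaleR)

definition first_beating_set :: "real^'n^'n \<Rightarrow> real^'n \<Rightarrow> (real^'n) set" where
  "first_beating_set C l = {x. l \<bullet> x = 0 \<and> l \<bullet> (C *v x) = 0}"

definition invariant_guard :: "real^'n^'n \<Rightarrow> real^'n \<Rightarrow> (real^'n) set" where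
  "invariant_guard A l = {x \<in> guard_hyperplane l. l \<bullet> (A *v x) = 0}"

definition Q_tilde :: "real^'n^'n \<Rightarrow> real^'m^'n \<Rightarrow> real^'m^'m \<Rightarrow> real^'n^'n" where
  "Q_tilde Q N R = Q - N ** matrix_inv R ** transpose N"

definition A_tilde ::
  "real^'n^'n \<Rightarrow> real^'m^'n \<Rightarrow> real^'m^'n \<Rightarrow> real^'m^'m \<Rightarrow> real^'n^'n" where
  "A_tilde A B N R = A - B ** matrix_inv R ** transpose N"

definition R_tilde :: "real^'m^'n \<Rightarrow> real^'m^'m \<Rightarrow> real^'n^'n" where
  "R_tilde B R = B ** matrix_inv R ** transpose B"

definition hamiltonian ::
  "real^'n^'n \<Rightarrow> real^'m^'n \<Rightarrow> real^'m^'n \<Rightarrow> real^'n^'n \<Rightarrow> real^'m^'m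
    \<Rightarrow> real^'n \<Rightarrow> real^'n \<Rightarrow> real" where
  "hamiltonian A B N Q R x p =
    1/2 * (x \<bullet> (Q_tilde Q N R *v x)) + p \<bullet> (A_tilde A B N R *v x)
      - 1/2 * (p \<bullet> (R_tilde B R *v p))"

(* x is the pre-reset state, pp = p^+ and pm = p^-. *)
definition costate_jump ::
  "real^'n^'n \<Rightarrow> real^'m^'n \<Rightarrow> real^'n^'n \<Rightarrow> real^'m^'n \<Rightarrow> real^'n^'n \<Rightarrow> real^'m^'m
    \<Rightarrow> real^'n \<Rightarrow> real^'n \<Rightarrow> real^'n \<Rightarrow> real^'n \<Rightarrow> real \<Rightarrow> bool" where
  "costate_jump A B C N Q R l x pp pm \<epsilon> \<longleftrightarrow>
    pm = transpose C *v pp + \<epsilon> *\<^sub>R l \<and>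
    hamiltonian A B N Q R (C *v x) pp = hamiltonian A B N Q R x pm"

end

theory Submission
  imports Defs
begin

(* Weak actuation makes l orthogonal to the columns of B. Hence the quadratic
   term of the Hamiltonian does not see the direction l, and H(x, p + eps l) is affine in eps
   with slope l . A x, which is nonzero off the invariant guard. *)

text \<open>Along a curve that stays in the hyperplane, the function
  \<open>l \<bullet> \<gamma> t\<close> vanishes for all t near 0. Its derivative at 0, which is
  \<open>l \<bullet> v\<close>, must therefore be that of the zero function.\<close>

lemma tangent_vectors_guard_hyperplane:
  assumes "v \<in> tangent_vectors (guard_hyperplane l) x"
  shows "l \<bullet> v = 0"
proof -
  from assms obtain \<gamma> e where e: "e > 0"
    and sub: "\<gamma> ` {-e<..<e} \<subseteq> guard_hyperplane l"
    and deriv: "(\<gamma> has_vector_derivative v) (at (0::real))"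
    unfolding tangent_vectors_def by blast
  have "((\<lambda>t. l \<bullet> \<gamma> t) has_vector_derivative l \<bullet> v) (at 0)"
    using bounded_linear.has_vector_derivative[OF bounded_linear_inner_right deriv] .
  then have "((\<lambda>t. 0) has_vector_derivative l \<bullet> v) (at (0::real))"
  proof (rule has_vector_derivative_transform_within_open)
    show "open {-e<..<e}" "0 \<in> {-e<..<e}" using e by auto
    show "l \<bullet> \<gamma> t = 0" if "t \<in> {-e<..<e}" for t
      using that sub by (simp add: guard_hyperplane_def image_subset_iff)
  qed
  then show ?thesis
    using vector_derivative_unique_at has_vector_derivative_const by blast
qed

text \<open>The control fields are constant, so tangency at a single guard point, the origin,
  already constrains every column of \<open>B\<close>.\<close>

lemma weakly_actuated_resets_orthogonal:
  fixes B :: "real^'m^'n"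
  assumes "weakly_actuated_resets (linear_hybrid_system A B C l)"
  shows "transpose B *v l = 0"
proof -
  have "0 \<in> guard_hyperplane l"
    by (simp add: guard_hyperplane_def)
  with assms have "column i B \<in> tangent_vectors (guard_hyperplane l) 0" for i
    by (simp add: weakly_actuated_resets_def linear_hybrid_system_def)
  then have "l \<bullet> column i B = 0" for i
    by (rule tangent_vectors_guard_hyperplane)
  then show ?thesis
    by (simp add: vec_eq_iff matrix_vector_mul_component transpose_def column_def inner_commute)
qed

lemma hamiltonian_add_orthogonal:
  fixes A :: "real^'n^'n" and B N :: "real^'m^'n"
  assumes "transpose B *v l = 0"
  shows "hamiltonian A B N Q R x (p + \<epsilon> *\<^sub>R l) = hamiltonian A B N Q R x p + \<epsilon> * (l \<bullet> (A *v x))"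
proof -
  have lB: "l v* B = 0"
    using assms by simp
  have B: "l \<bullet> (B *v w) = 0" for w
    by (simp add: lB flip: dot_lmul_matrix)
  \<comment> \<open>The correction subtracted from \<open>A\<close> takes values in the range of
    \<open>B\<close>, which is orthogonal to \<open>l\<close>.\<close>
  have A_tilde: "l \<bullet> (A_tilde A B N R *v x) = l \<bullet> (A *v x)"
    by (simp add: A_tilde_def matrix_vector_mult_diff_rdistrib inner_diff_right B
        flip: matrix_vector_mul_assoc)
  \<comment> \<open>Both cross terms and the square of \<open>\<epsilon>\<close> in the quadratic
    part must vanish: the rightmost factor \<open>transpose B\<close> kills \<open>l\<close>, and
    the leftmost factor \<open>B\<close> maps into the orthogonal complement of
    \<open>l\<close>.\<close>
  have R_tilde_right: "R_tilde B R *v l = 0"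
    by (simp add: R_tilde_def lB flip: matrix_vector_mul_assoc)
  have R_tilde_left: "l \<bullet> (R_tilde B R *v q) = 0" for q
    by (simp add: R_tilde_def B flip: matrix_vector_mul_assoc)
  show ?thesis
    by (simp add: hamiltonian_def matrix_vector_right_distrib matrix_vector_mult_scaleR
        inner_add_left A_tilde R_tilde_right R_tilde_left)
qed

theorem proposition11:
  fixes A C Q :: "real^'n^'n" and B N :: "real^'m^'n" and R :: "real^'m^'m"
    and l :: "real^'n"
  assumes "psd_matrix Q"
    and "pd_matrix R"
    and "l \<noteq> 0"
    and "weakly_actuated_resets (linear_hybrid_system A B C l)"
  shows "\<forall>x \<in> guard_hyperplane l - (invariant_guard A l \<union> first_beating_set C l).
           \<forall>pp :: real^'n.
             (\<exists>!\<epsilon>. \<exists>pm. costate_jump A B C N Q R l x pp pm \<epsilon>) \<and>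
             (\<exists>!pm. \<exists>\<epsilon>. costate_jump A B C N Q R l x pp pm \<epsilon>)"
proof (intro ballI allI)
  fix x pp
  assume "x \<in> guard_hyperplane l - (invariant_guard A l \<union> first_beating_set C l)"
  then have slope: "l \<bullet> (A *v x) \<noteq> 0"
    by (simp add: invariant_guard_def)
  define p where "p = transpose C *v pp"
  \<comment> \<open>This is the root of the energy condition, which is affine in the multiplier with
    nonzero slope \<open>l \<bullet> (A *v x)\<close>.\<close>
  define \<epsilon>\<^sub>0 where "\<epsilon>\<^sub>0 =
    (hamiltonian A B N Q R (C *v x) pp - hamiltonian A B N Q R x p) / (l \<bullet> (A *v x))"
  have "costate_jump A B C N Q R l x pp pm \<epsilon> \<longleftrightarrow> pm = p + \<epsilon> *\<^sub>R l \<and>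
      hamiltonian A B N Q R (C *v x) pp = hamiltonian A B N Q R x p + \<epsilon> * (l \<bullet> (A *v x))" for pm \<epsilon>
    unfolding costate_jump_def p_def[symmetric]
    using hamiltonian_add_orthogonal[OF weakly_actuated_resets_orthogonal[OF assms(4)]] by auto
  moreover have "hamiltonian A B N Q R (C *v x) pp = hamiltonian A B N Q R x p + \<epsilon> * (l \<bullet> (A *v x))
      \<longleftrightarrow> \<epsilon> = \<epsilon>\<^sub>0" for \<epsilon>
    using slope by (auto simp: \<epsilon>\<^sub>0_def field_simps)
  \<comment> \<open>The jump conditions hold for exactly one pair of \<open>pm\<close> and
    \<open>\<epsilon>\<close>, which gives both uniqueness claims at once.\<close>
  ultimately have "costate_jump A B C N Q R l x pp pm \<epsilon> \<longleftrightarrow> pm = p + \<epsilon>\<^sub>0 *\<^sub>R l \<and> \<epsilon> = \<epsilon>\<^sub>0" for pm \<epsilon>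
    by auto
  then show "(\<exists>!\<epsilon>. \<exists>pm. costate_jump A B C N Q R l x pp pm \<epsilon>) \<and>
      (\<exists>!pm. \<exists>\<epsilon>. costate_jump A B C N Q R l x pp pm \<epsilon>)"
    by simp
qed

end
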